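(* Let $P_1,P_2,P_3$ be orthogonal projections on a Hilbert space $H$ such that $P_2$ and $P_3$ are mutually orthogonal, and let $\tilde P_1,\tilde P_2,\tilde P_3$ be orthogonal projections on a Hilbert space $\tilde H$ such that $\tilde P_2$ and $\tilde P_3$ are mutually orthogonal. Consider the systems of five subspaces $$S_{P_1,P_2\bot P_3}=(H;\operatorname{Im}P_1,\operatorname{Im}P_1^\bot,\operatorname{Im}P_2,\operatorname{Im}P_3,\operatorname{Im}(P_2+P_3)^\bot)$$ and, defined analogously from $\tilde P_1,\tilde P_2,\tilde P_3$ on $\tilde H$, $S_{\tilde P_1,\tilde P_2\bot\tilde P_3}$. Then the system $S_{P_1,P_2\bot P_3}$ is transitive if and only if the triple of projections $P_1,P_2,P_3$ is irreducible. Moreover, $S_{P_1,P_2\bot P_3}\cong S_{\tilde P_1,\tilde P_2\bot\tilde P_3}$ if and only if the triple $P_1,P_2,P_3$ is unitarily equivalent to the triple $\tilde P_1,\tilde P_2,\tilde P_3$.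
   Context: Hilbert spaces are complex and nonzero; $B(H)$ denotes the bounded linear operators on $H$. For an orthogonal projection $P$ on $H$, $P^\bot=I_H-P$. Two orthogonal projections $P,Q$ are mutually orthogonal if $PQ=0$. A system of $n$ subspaces $S=(H;H_1,\dots,H_n)$ consists of a Hilbert space $H$ and $n$ (closed) subspaces of it. Systems $S=(H;H_1,\dots,H_n)$ and $\tilde S=(\tilde H;\tilde H_1,\dots,\tilde H_n)$ are isomorphic, $S\cong\tilde S$, if there is a bounded linear bijection $R:H\to\tilde H$ with $R(H_i)=\tilde H_i$ for all $i$. Put $\mathrm{End}(S)=\{R\in B(H) : R(H_i)\subset H_i,\ i=1,\dots,n\}$; $S$ is transitive if $\mathrm{End}(S)=\mathbb C I_H$. A collection of orthogonal projections on $H$ is irreducible if the only closed subspaces of $H$ invariant under all of them are $\{0\}$ and $H$. Collections $P_1,\dots,P_m$ on $H$ and $\tilde P_1,\dots,\tilde P_m$ on $\tilde H$ are unitarily equivalent if there is a unitary $W:H\to\tilde H$ with $WP_i=\tilde P_iW$ for all $i$. *)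

theory Defs
  imports "HOL-Analysis.Analysis"
begin

text \<open>
  A complex Hilbert space is modelled as a type. The class extends the real Hilbert space
  structure of the library, which has to be the underlying one: real scalar multiplication is
  the restriction of the complex one and the real inner product is the real part of the complex
  one. The norm, the topology and completeness are therefore those of the complex Hilbert space.
  The inner product is linear in the first and antilinear in the second argument. The class
  admits the zero space.
\<close>

class complex_vector = real_vector +
  fixes scaleC :: "complex \<Rightarrow> 'a \<Rightarrow> 'a"  (infixr "*\<^sub>C" 75)
  assumes scaleC_add_right: "c *\<^sub>C (x + y) = c *\<^sub>C x + c *\<^sub>C y"
    and scaleC_add_left: "(c + d) *\<^sub>C x = c *\<^sub>C x + d *\<^sub>C x"
    and scaleC_scaleC: "c *\<^sub>C (d *\<^sub>C x) = (c * d) *\<^sub>C x"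
    and scaleC_one: "1 *\<^sub>C x = x"
    and scaleR_scaleC: "r *\<^sub>R x = complex_of_real r *\<^sub>C x"

global_interpretation complex_vector: vector_space "scaleC :: complex \<Rightarrow> 'a \<Rightarrow> 'a::complex_vector"
  by unfold_locales (simp_all add: scaleC_add_right scaleC_add_left scaleC_scaleC scaleC_one)

class complex_hilbert_space = complex_vector + real_inner + banach +
  fixes cinner :: "'a \<Rightarrow> 'a \<Rightarrow> complex"
  assumes cinner_commute: "cinner x y = cnj (cinner y x)"
    and cinner_add_left: "cinner (x + y) z = cinner x z + cinner y z"
    and cinner_scaleC_left: "cinner (c *\<^sub>C x) y = c * cinner x y"
    and inner_eq_Re_cinner: "inner x y = Re (cinner x y)"

instantiation complex :: complex_hilbert_space
begin

definition scaleC_complex :: "complex \<Rightarrow> complex \<Rightarrow> complex"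
  where "scaleC_complex c x = c * x"

definition cinner_complex :: "complex \<Rightarrow> complex \<Rightarrow> complex"
  where "cinner_complex x y = x * cnj y"

instance
  by standard (simp_all add: scaleC_complex_def cinner_complex_def inner_complex_def
      algebra_simps scaleR_conv_of_real)

end

definition bounded_clinear :: "('a::complex_hilbert_space \<Rightarrow> 'b::complex_hilbert_space) \<Rightarrow> bool"
  where "bounded_clinear f \<longleftrightarrow> bounded_linear f \<and> (\<forall>c x. f (c *\<^sub>C x) = c *\<^sub>C f x)"

definition closed_csubspace :: "'a::complex_hilbert_space set \<Rightarrow> bool"
  where "closed_csubspace K \<longleftrightarrow> complex_vector.subspace K \<and> closed K"

definition unitary_map :: "('a::complex_hilbert_space \<Rightarrow> 'b::complex_hilbert_space) \<Rightarrow> bool"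
  where "unitary_map W \<longleftrightarrow>
    bounded_clinear W \<and> surj W \<and> (\<forall>x y. cinner (W x) (W y) = cinner x y)"

definition orthogonal_projection :: "('a::complex_hilbert_space \<Rightarrow> 'a) \<Rightarrow> bool"
  where "orthogonal_projection P \<longleftrightarrow>
    bounded_clinear P \<and> P \<circ> P = P \<and> (\<forall>x y. cinner (P x) y = cinner x (P y))"

definition mutually_orthogonal ::
    "('a::complex_hilbert_space \<Rightarrow> 'a) \<Rightarrow> ('a \<Rightarrow> 'a) \<Rightarrow> bool"
  where "mutually_orthogonal P Q \<longleftrightarrow> P \<circ> Q = (\<lambda>x. 0)"

definition proj_compl :: "('a::complex_hilbert_space \<Rightarrow> 'a) \<Rightarrow> 'a \<Rightarrow> 'a"
  where "proj_compl P = (\<lambda>x. x - P x)"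

text \<open>
  A system of \<open>n\<close> subspaces is a list of length \<open>n\<close>; the ambient space is the whole type.
\<close>

definition subspace_system :: "'a::complex_hilbert_space set list \<Rightarrow> bool"
  where "subspace_system S \<longleftrightarrow> (\<forall>K \<in> set S. closed_csubspace K)"

definition isomorphic_systems ::
    "'a::complex_hilbert_space set list \<Rightarrow> 'b::complex_hilbert_space set list \<Rightarrow> bool"
  where "isomorphic_systems S T \<longleftrightarrow>
    (\<exists>R. bounded_clinear R \<and> bij R \<and> list_all2 (\<lambda>K L. R ` K = L) S T)"

definition End_system :: "'a::complex_hilbert_space set list \<Rightarrow> ('a \<Rightarrow> 'a) set"
  where "End_system S = {R. bounded_clinear R \<and> (\<forall>K \<in> set S. R ` K \<subseteq> K)}"

definition transitive_system :: "'a::complex_hilbert_space set list \<Rightarrow> bool"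
  where "transitive_system S \<longleftrightarrow> End_system S = {R. \<exists>c. R = (\<lambda>x. c *\<^sub>C x)}"

definition irreducible_projections :: "('a::complex_hilbert_space \<Rightarrow> 'a) list \<Rightarrow> bool"
  where "irreducible_projections Ps \<longleftrightarrow>
    (\<forall>M. closed_csubspace M \<and> (\<forall>P \<in> set Ps. P ` M \<subseteq> M) \<longrightarrow> M = {0} \<or> M = UNIV)"

definition unitarily_equivalent ::
    "('a::complex_hilbert_space \<Rightarrow> 'a) list \<Rightarrow> ('b::complex_hilbert_space \<Rightarrow> 'b) list \<Rightarrow> bool"
  where "unitarily_equivalent Ps Qs \<longleftrightarrow>
    (\<exists>W. unitary_map W \<and> list_all2 (\<lambda>P Q. W \<circ> P = Q \<circ> W) Ps Qs)"

definition five_subspaces ::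
    "('a::complex_hilbert_space \<Rightarrow> 'a) \<Rightarrow> ('a \<Rightarrow> 'a) \<Rightarrow> ('a \<Rightarrow> 'a) \<Rightarrow> 'a set list"
  where "five_subspaces P1 P2 P3 =
    [range P1, range (proj_compl P1), range P2, range P3, range (proj_compl (\<lambda>x. P2 x + P3 x))]"

lemma orthogonal_projection_compl:
  assumes "orthogonal_projection P"
  shows "orthogonal_projection (proj_compl P)"
proof -
  have bl: "bounded_linear P" and sc: "\<And>c x. P (c *\<^sub>C x) = c *\<^sub>C P x"
    and idem: "\<And>x. P (P x) = P x" and sa: "\<And>x y. cinner (P x) y = cinner x (P y)"
    using assms by (auto simp: orthogonal_projection_def bounded_clinear_def fun_eq_iff)
  have diff_left: "cinner (a - b) c = cinner a c - cinner b c" for a b c :: 'a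
    using cinner_add_left[of "a - b" b c] by simp
  have diff_right: "cinner a (b - c) = cinner a b - cinner a c" for a b c :: 'a
    using diff_left[of b c a] by (metis cinner_commute complex_cnj_diff)
  show ?thesis
    unfolding orthogonal_projection_def bounded_clinear_def proj_compl_def
    using bl by (auto simp: bounded_linear_sub bounded_linear_ident sc idem sa diff_left
        diff_right fun_eq_iff complex_vector.scale_right_diff_distrib linear_simps)
qed

lemma orthogonal_projection_add:
  assumes P: "orthogonal_projection P" and Q: "orthogonal_projection Q"
    and PQ: "mutually_orthogonal P Q"
  shows "orthogonal_projection (\<lambda>x. P x + Q x)"
proof -
  have bl: "bounded_linear P" "bounded_linear Q"
    and sc: "\<And>c x. P (c *\<^sub>C x) = c *\<^sub>C P x" "\<And>c x. Q (c *\<^sub>C x) = c *\<^sub>C Q x"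
    and idem: "\<And>x. P (P x) = P x" "\<And>x. Q (Q x) = Q x"
    and sa: "\<And>x y. cinner (P x) y = cinner x (P y)" "\<And>x y. cinner (Q x) y = cinner x (Q y)"
    using P Q by (auto simp: orthogonal_projection_def bounded_clinear_def fun_eq_iff)
  have add_right: "cinner a (b + c) = cinner a b + cinner a c" for a b c :: 'a
    using cinner_add_left[of b c a] by (metis cinner_commute complex_cnj_add)
  have PQ0: "P (Q x) = 0" for x
    using PQ by (simp add: mutually_orthogonal_def fun_eq_iff)
  have zero: "cinner 0 y = 0" for y :: 'a
    using cinner_add_left[of 0 0 y] by simp
  have QP0: "Q (P x) = 0" for x
  proof -
    have "cinner (Q (P x)) (Q (P x)) = cinner (P x) (Q (Q (P x)))"
      by (rule sa)
    also have "\<dots> = cinner x (P (Q (Q (P x))))"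
      by (rule sa)
    also have "\<dots> = 0"
      by (metis PQ0 cinner_commute zero complex_cnj_zero)
    finally have "inner (Q (P x)) (Q (P x)) = 0"
      by (simp add: inner_eq_Re_cinner)
    then show ?thesis by simp
  qed
  show ?thesis
    unfolding orthogonal_projection_def bounded_clinear_def
    using bl by (auto simp: bounded_linear_add sc idem sa cinner_add_left add_right PQ0 QP0
        fun_eq_iff scaleC_add_right linear_simps)
qed

lemma closed_csubspace_range:
  assumes "orthogonal_projection P"
  shows "closed_csubspace (range P)"
proof -
  have bl: "bounded_linear P" and sc: "\<And>c x. P (c *\<^sub>C x) = c *\<^sub>C P x"
    and idem: "\<And>x. P (P x) = P x"
    using assms by (auto simp: orthogonal_projection_def bounded_clinear_def fun_eq_iff)
  have eq: "range P = {x. P x = x}"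
    using idem by (auto simp: image_iff) metis
  have "closed {x. P x = x}"
    using bl by (intro closed_Collect_eq linear_continuous_on continuous_on_id)
  moreover have "complex_vector.subspace {x. P x = x}"
    using bl by (auto simp: complex_vector.subspace_def sc linear_simps)
  ultimately show ?thesis
    by (simp add: closed_csubspace_def eq)
qed

lemma subspace_system_five_subspaces:
  assumes "orthogonal_projection P1" "orthogonal_projection P2" "orthogonal_projection P3"
    and "mutually_orthogonal P2 P3"
  shows "subspace_system (five_subspaces P1 P2 P3)"
  using assms
  by (simp add: subspace_system_def five_subspaces_def closed_csubspace_range
      orthogonal_projection_compl orthogonal_projection_add)

end

theory Submission
  imports Defs
begin

text \<open>
  The five subspaces carry the same information as the projections: \<open>H\<close> is the direct sum of
  \<open>Im P\<^sub>1\<close> and its complement, and also of \<open>Im P\<^sub>2\<close>, \<open>Im P\<^sub>3\<close> and \<open>Im (P\<^sub>2 + P\<^sub>3)\<^sup>\<bottom>\<close>. A linear map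
  that respects the summands of a direct sum intertwines the projections onto them, so a
  bounded operator maps one system into another iff it intertwines the two triples
  (\<open>maps_five_subspaces_iff_intertwines\<close>). In particular the endomorphisms of the system are the
  commutant of the triple. Both equivalences are thus statements about families of self-adjoint
  operators.

  Transitivity is Schur's lemma. If the commutant is trivial, the orthogonal projection onto an
  invariant subspace lies in it and is \<open>0\<close> or \<open>1\<close>. Conversely, let the family be irreducible. A
  self-adjoint operator \<open>T\<close> in the commutant is a real scalar: kernels of operators in the
  commutant are invariant, hence \<open>{0}\<close> or \<open>H\<close>, so the commutant has no zero divisors; for
  \<open>B = T - a\<close> the product \<open>(\<bar>B\<bar> - B)(\<bar>B\<bar> + B)\<close> vanishes, whence \<open>B = \<plusminus>\<bar>B\<bar>\<close>, and choosing \<open>a\<close> as the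
  value of the quadratic form of \<open>T\<close> at a unit vector \<open>v\<close> forces \<open>B v = 0\<close> and so \<open>B = 0\<close>
  (\<open>selfadjoint_commuting_imp_scalar\<close>). A general operator in the commutant is split into its
  real and imaginary parts.

  Unitary equivalence comes from the polar decomposition \<open>R = W \<bar>R\<bar>\<close> of an isomorphism \<open>R\<close>: since
  the projections are self-adjoint, \<open>R\<^sup>*R\<close> and hence \<open>\<bar>R\<bar>\<close> commute with them, so the unitary factor
  \<open>W\<close> still intertwines (\<open>bijective_intertwiner_imp_unitary_intertwiner\<close>).

  Both parts rest on adjoints, which come from the Riesz representation theorem, and on the
  absolute value of an operator, which is the limit of an explicit polynomial iteration. This
  analysis is done over the reals: multiplication by \<open>\<i>\<close> is one more bounded operator, complex
  linearity is commutation with it, and complex subspaces are the real ones that it leaves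
  invariant.
\<close>

section \<open>Riesz representation, orthogonal decomposition and adjoints\<close>

text \<open>
  The representing vector minimises \<open>\<parallel>y\<parallel>\<^sup>2 - 2 f y\<close> on \<open>M\<close>: the parallelogram law makes minimising
  sequences Cauchy, and the first-order condition at the minimum is \<open>f = \<langle>z, \<cdot>\<rangle>\<close> on \<open>M\<close>. With
  \<open>M = UNIV\<close> this is the Riesz theorem; with \<open>f = \<langle>x, \<cdot>\<rangle>\<close> it is the projection theorem.
\<close>

lemma Riesz_on_closed_subspace:
  fixes f :: "'a::{real_inner,banach} \<Rightarrow> real"
  assumes f: "bounded_linear f" and cl: "closed M" and sub: "subspace M"
  shows "\<exists>z\<in>M. \<forall>y\<in>M. f y = inner z y"
proof -
  interpret f: bounded_linear f by (rule f)
  define \<phi> where "\<phi> y = (norm y)\<^sup>2 - 2 * f y" for y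
  obtain K where K: "\<And>y. norm (f y) \<le> norm y * K"
    using f.bounded by blast
  have "- K\<^sup>2 \<le> \<phi> y" for y
  proof -
    have "f y \<le> norm y * K"
      using K[of y] by simp
    moreover have "0 \<le> (norm y - K)\<^sup>2"
      by simp
    ultimately show ?thesis
      unfolding \<phi>_def power2_diff by (simp add: algebra_simps)
  qed
  then have bdd: "bdd_below (\<phi> ` M)"
    by (intro bdd_belowI2)
  have M0: "0 \<in> M"
    using sub by (rule subspace_0)
  define d where "d = Inf (\<phi> ` M)"
  have d_le: "d \<le> \<phi> y" if "y \<in> M" for y
    unfolding d_def using bdd that by (rule cINF_lower)
  have "\<exists>y\<in>M. \<phi> y < d + inverse (real (Suc n))" for n
  proof -
    have "Inf (\<phi> ` M) < d + inverse (real (Suc n))"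
      by (simp add: d_def)
    then show ?thesis
      using M0 bdd by (subst (asm) cInf_less_iff) auto
  qed
  then obtain u where uM: "\<And>n. u n \<in> M" and u: "\<And>n. \<phi> (u n) < d + inverse (real (Suc n))"
    by metis
  \<comment> \<open>the parallelogram law: the linear part of \<open>\<phi>\<close> cancels\<close>
  have par: "\<phi> x + \<phi> y = 2 * \<phi> ((1/2) *\<^sub>R (x + y)) + (norm (x - y))\<^sup>2 / 2" for x y
    by (simp add: \<phi>_def power2_norm_eq_inner f.add f.scaleR inner_add_left inner_add_right
        inner_diff_left inner_diff_right inner_commute field_simps)
  have close: "(dist (u m) (u n))\<^sup>2 \<le> 4 * inverse (real (Suc N))" if "N \<le> m" "N \<le> n" for m n N
  proof -
    have small: "\<phi> (u k) \<le> d + inverse (real (Suc N))" if "N \<le> k" for k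
      using u[of k] le_imp_inverse_le[of "real (Suc N)" "real (Suc k)"] that by linarith
    have "d \<le> \<phi> ((1/2) *\<^sub>R (u m + u n))"
      by (intro d_le subspace_scale[OF sub] subspace_add[OF sub] uM)
    then show ?thesis
      using par[of "u m" "u n"] small[OF that(1)] small[OF that(2)] unfolding dist_norm by argo
  qed
  have "Cauchy u"
  proof (rule metric_CauchyI)
    fix e :: real assume "e > 0"
    then have "e\<^sup>2 / 4 > 0" by simp
    then obtain N where N: "inverse (real (Suc N)) < e\<^sup>2 / 4"
      using reals_Archimedean by blast
    have "dist (u m) (u n) < e" if "m \<ge> N" "n \<ge> N" for m n
    proof (rule power2_less_imp_less)
      have "4 * inverse (real (Suc N)) < e\<^sup>2"
        using N by argo
      then show "(dist (u m) (u n))\<^sup>2 < e\<^sup>2"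
        using close[OF that] by (rule le_less_trans[rotated])
    qed (use \<open>e > 0\<close> in simp)
    then show "\<exists>N. \<forall>m\<ge>N. \<forall>n\<ge>N. dist (u m) (u n) < e"
      by blast
  qed
  then obtain z where z: "u \<longlonglongrightarrow> z"
    by (meson Cauchy_convergent_iff convergentD)
  have zM: "z \<in> M"
    using closed_sequentially[OF cl _ z] uM by blast
  have "\<phi> z \<le> d"
  proof (rule LIMSEQ_le)
    show "(\<lambda>n. \<phi> (u n)) \<longlonglongrightarrow> \<phi> z"
      unfolding \<phi>_def using z by (intro tendsto_intros f.tendsto)
    show "(\<lambda>n. d + inverse (real (Suc n))) \<longlonglongrightarrow> d"
      by (rule LIMSEQ_inverse_real_of_nat_add)
  qed (use u less_imp_le in blast)
  have "f y = inner z y" if y: "y \<in> M" for y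
  proof (cases "y = 0")
    case False
    define c where "c = inner z y - f y"
    \<comment> \<open>the minimiser of the quadratic function \<open>t \<mapsto> \<phi> (z + t y)\<close>\<close>
    define t where "t = - c / (norm y)\<^sup>2"
    have "z + t *\<^sub>R y \<in> M"
      by (intro subspace_add[OF sub] subspace_scale[OF sub] zM y)
    then have "\<phi> z \<le> \<phi> (z + t *\<^sub>R y)"
      using d_le \<open>\<phi> z \<le> d\<close> by fastforce
    also have "\<dots> = \<phi> z + 2 * t * c + t\<^sup>2 * (norm y)\<^sup>2"
      unfolding \<phi>_def c_def power2_norm_eq_inner f.add f.scaleR
      by (simp add: inner_add_left inner_add_right inner_commute algebra_simps power2_eq_square)
    also have "\<dots> = \<phi> z - c\<^sup>2 / (norm y)\<^sup>2"
      using False by (simp add: t_def field_simps power2_eq_square)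
    finally have "c\<^sup>2 / (norm y)\<^sup>2 \<le> 0"
      by simp
    with False have "c = 0"
      by (simp add: divide_le_0_iff)
    then show ?thesis
      by (simp add: c_def)
  qed (simp add: f.zero)
  with zM show ?thesis
    by blast
qed

lemma orthogonal_decomposition:
  fixes M :: "'a::{real_inner,banach} set"
  assumes "closed M" "subspace M"
  shows "\<exists>z\<in>M. \<forall>y\<in>M. inner (x - z) y = 0"
  using Riesz_on_closed_subspace[OF bounded_linear_inner_right[of x] assms]
  by (simp add: inner_diff_left)

lemma adjoint_exists:
  fixes R :: "'a::{real_inner,banach} \<Rightarrow> 'b::real_inner"
  assumes R: "bounded_linear R"
  obtains R' where "bounded_linear R'" "\<And>x y. inner (R x) y = inner x (R' y)"
proof -
  interpret R: bounded_linear R by (rule R)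
  have "\<exists>z. \<forall>x. inner y (R x) = inner z x" for y
    using Riesz_on_closed_subspace[OF bounded_linear_compose[OF bounded_linear_inner_right[of y] R],
      of UNIV] by simp
  then obtain R' where "\<And>x y. inner y (R x) = inner (R' y) x"
    by metis
  then have R': "inner (R x) y = inner x (R' y)" for x y
    by (simp add: inner_commute)
  obtain K where "K \<ge> 0" and K: "\<And>x. norm (R x) \<le> norm x * K"
    using R.nonneg_bounded by blast
  have "bounded_linear R'"
  proof (rule bounded_linear_intro)
    show "R' (x + y) = R' x + R' y" for x y
      by (rule vector_eq_rdot[THEN iffD1])
        (metis R' inner_add_right inner_commute)
    show "R' (r *\<^sub>R x) = r *\<^sub>R R' x" for r x
      by (rule vector_eq_rdot[THEN iffD1])
        (metis R' inner_scaleR_right inner_commute)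
    show "norm (R' y) \<le> norm y * K" for y
    proof (cases "R' y = 0")
      case False
      have "norm (R' y) * norm (R' y) = inner (R (R' y)) y"
        by (simp add: R' dot_square_norm power2_eq_square)
      also have "\<dots> \<le> norm (R (R' y)) * norm y"
        by (rule norm_cauchy_schwarz)
      also have "\<dots> \<le> norm (R' y) * K * norm y"
        by (intro mult_right_mono K) simp
      finally show ?thesis
        using False by (simp add: mult.assoc mult_left_le_imp_le mult.commute)
    qed (use \<open>K \<ge> 0\<close> in simp)
  qed
  then show thesis
    using R' by (rule that)
qed

section \<open>The absolute value of an operator\<close>

text \<open>
  In terms of the limit \<open>Y\<close> the equation reads \<open>(1 - Y)\<^sup>2 = 1 - X\<close>, so this produces a square root
  of \<open>1 - X\<close>. The iteration \<open>Z \<mapsto> (X + Z\<^sup>2) / 2\<close> started at \<open>0\<close> is dominated in norm by the scalar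
  iteration \<open>t \<mapsto> (1 + t\<^sup>2) / 2\<close>, which increases and is bounded by \<open>1\<close>; hence it converges in
  norm even when \<open>\<parallel>X\<parallel> = 1\<close>. The second property transfers to \<open>Y\<close> everything that is closed and
  preserved by the iteration: bounds, self-adjointness, commutation relations.
\<close>

lemma sqrt_iteration_limit:
  fixes X :: "'a::banach \<Rightarrow>\<^sub>L 'a"
  assumes X: "norm X \<le> 1"
  obtains Y where "Y = (1/2) *\<^sub>R (X + (Y o\<^sub>L Y))"
    and "\<And>A. closed A \<Longrightarrow> 0 \<in> A \<Longrightarrow> \<forall>Z\<in>A. (1/2) *\<^sub>R (X + (Z o\<^sub>L Z)) \<in> A \<Longrightarrow> Y \<in> A"
proof -
  define F where "F = (\<lambda>Z. (1/2) *\<^sub>R (X + (Z o\<^sub>L Z)))"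
  define Y where "Y = (\<lambda>n. (F ^^ n) 0)"
  define y where "y = (\<lambda>n. ((\<lambda>t::real. (1 + t\<^sup>2) / 2) ^^ n) 0)"
  have Y0: "Y 0 = 0" and YS: "Y (Suc n) = F (Y n)" for n
    by (simp_all add: Y_def)
  have y0: "y 0 = 0" and yS: "y (Suc n) = (1 + (y n)\<^sup>2) / 2" for n
    by (simp_all add: y_def)
  have y_bounds: "0 \<le> y n \<and> y n \<le> 1" for n
  proof (induction n)
    case (Suc n)
    then have "(y n)\<^sup>2 \<le> 1"
      by (simp add: power_le_one)
    then show ?case
      by (simp add: yS)
  qed (simp add: y0)
  have y_step: "y n \<le> y (Suc n)" for n
  proof -
    have "0 \<le> (1 - y n)\<^sup>2"
      by simp
    then show ?thesis
      unfolding yS power2_diff by simp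
  qed
  have norm_Y: "norm (Y n) \<le> y n" for n
  proof (induction n)
    case (Suc n)
    have "norm (X + (Y n o\<^sub>L Y n)) \<le> norm X + norm (Y n) * norm (Y n)"
      using norm_triangle_ineq[of X "Y n o\<^sub>L Y n"] norm_blinfun_compose[of "Y n" "Y n"] by linarith
    also have "\<dots> \<le> 1 + y n * y n"
      using X Suc y_bounds[of n] by (intro add_mono mult_mono) auto
    finally show ?case
      by (simp add: YS F_def yS power2_eq_square)
  qed (simp add: Y0 y0)
  have Y_step: "norm (Y (Suc n) - Y n) \<le> y (Suc n) - y n" for n
  proof (induction n)
    case 0
    show ?case
      using norm_Y[of 1] by (simp add: Y0 y0)
  next
    case (Suc n)
    let ?D = "Y (Suc n) - Y n"
    \<comment> \<open>\<open>A\<^sup>2 - B\<^sup>2 = A (A - B) + (A - B) B\<close> holds for operators that need not commute\<close>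
    have "Y (Suc (Suc n)) - Y (Suc n) = (1/2) *\<^sub>R ((Y (Suc n) o\<^sub>L ?D) + (?D o\<^sub>L Y n))"
      unfolding YS[of "Suc n"] YS[of n] F_def
      by (rule blinfun_eqI) (simp add: blinfun.bilinear_simps algebra_simps)
    then have "norm (Y (Suc (Suc n)) - Y (Suc n)) = norm ((Y (Suc n) o\<^sub>L ?D) + (?D o\<^sub>L Y n)) / 2"
      by simp
    also have "\<dots> \<le> (norm (Y (Suc n)) * norm ?D + norm ?D * norm (Y n)) / 2"
      by (intro divide_right_mono order_trans[OF norm_triangle_ineq] add_mono
          norm_blinfun_compose) simp
    also have "\<dots> \<le> (y (Suc n) * (y (Suc n) - y n) + (y (Suc n) - y n) * y n) / 2"
      using Suc norm_Y y_bounds y_step by (intro divide_right_mono add_mono mult_mono) auto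
    also have "\<dots> = y (Suc (Suc n)) - y (Suc n)"
      unfolding yS[of "Suc n"] yS[of n] by (simp add: power2_eq_square field_simps)
    finally show ?case .
  qed
  have Y_diff: "norm (Y (n + k) - Y n) \<le> y (n + k) - y n" for n k
  proof (induction k)
    case (Suc k)
    show ?case
      using norm_triangle_le[of "Y (Suc (n + k)) - Y (n + k)" "Y (n + k) - Y n"
          "y (Suc (n + k)) - y n"] Suc Y_step[of "n + k"] by simp
  qed simp
  have "incseq y"
    using y_step by (rule incseq_SucI)
  then have "Cauchy y"
    using y_bounds incseq_convergent[of y 1] by (metis LIMSEQ_imp_Cauchy)
  have "Cauchy Y"
  proof (rule metric_CauchyI)
    fix e :: real assume "e > 0"
    then obtain N where N: "\<And>m n. m \<ge> N \<Longrightarrow> n \<ge> N \<Longrightarrow> norm (y m - y n) < e"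
      using CauchyD[OF \<open>Cauchy y\<close>] by blast
    have le: "dist (Y m) (Y n) < e" if "m \<ge> N" "n \<ge> m" for m n
      using Y_diff[of m "n - m"] N[of n m] that by (simp add: dist_norm norm_minus_commute)
    have "dist (Y m) (Y n) < e" if "m \<ge> N" "n \<ge> N" for m n
      using le[of m n] le[of n m] that by (cases "m \<le> n") (auto simp: dist_commute)
    then show "\<exists>M. \<forall>m\<ge>M. \<forall>n\<ge>M. dist (Y m) (Y n) < e"
      by blast
  qed
  then obtain L where L: "Y \<longlonglongrightarrow> L"
    by (meson Cauchy_convergent_iff convergentD)
  show thesis
  proof
    have "(\<lambda>n. Y (Suc n)) \<longlonglongrightarrow> (1/2) *\<^sub>R (X + (L o\<^sub>L L))"
      unfolding YS F_def using L
      by (intro tendsto_intros bounded_bilinear.tendsto[OF bounded_bilinear_blinfun_compose])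
    then show "L = (1/2) *\<^sub>R (X + (L o\<^sub>L L))"
      using LIMSEQ_Suc[OF L] LIMSEQ_unique by blast
  next
    fix A assume A: "closed A" "0 \<in> A" "\<forall>Z\<in>A. (1/2) *\<^sub>R (X + (Z o\<^sub>L Z)) \<in> A"
    have "Y n \<in> A" for n
      by (induction n) (use A in \<open>auto simp: Y0 YS F_def\<close>)
    with A(1) L show "L \<in> A"
      using closed_sequentially by blast
  qed
qed

text \<open>
  Here \<open>S = \<bar>B\<bar> = (B\<^sup>*B)\<^sup>1\<^sup>/\<^sup>2\<close>, obtained by the square root iteration for \<open>X = 1 - B\<^sup>*B / k\<^sup>2\<close>. The
  third property, definiteness of the quadratic form on the orthogonal complement of the kernel,
  is the consequence of positivity that Schur's lemma uses. The last one says that \<open>S\<close> lies in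
  the bicommutant of \<open>B\<^sup>*B\<close>.
\<close>

lemma absolute_value_exists:
  fixes B :: "'a::{real_inner,banach} \<Rightarrow> 'b::real_inner"
  assumes B: "bounded_linear B" and B': "bounded_linear B'"
    and adj: "\<And>x y. inner (B x) y = inner x (B' y)"
  obtains S where "bounded_linear S"
    and "\<forall>x y. inner (S x) y = inner x (S y)"
    and "\<forall>x. inner (S x) x = 0 \<longrightarrow> S x = 0"
    and "\<forall>x. S (S x) = B' (B x)"
    and "\<forall>C. bounded_linear C \<longrightarrow> (\<forall>x. C (B' (B x)) = B' (B (C x))) \<longrightarrow> (\<forall>x. C (S x) = S (C x))"
proof -
  interpret B: bounded_linear B by (rule B)
  interpret B': bounded_linear B' by (rule B')
  obtain k where "k > 0" and k: "\<And>x. norm (B x) \<le> norm x * k"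
    using B.pos_bounded by blast
  define X where "X = Blinfun (\<lambda>x. x - (1 / k\<^sup>2) *\<^sub>R B' (B x))"
  have bl: "bounded_linear (\<lambda>x. B' (B x))"
    using bounded_linear_compose[OF B' B] .
  have X_apply: "X x = x - (1 / k\<^sup>2) *\<^sub>R B' (B x)" for x
    unfolding X_def
    by (subst bounded_linear_Blinfun_apply)
      (intro bounded_linear_sub bounded_linear_ident bounded_linear_const_scaleR bl, simp)
  \<comment> \<open>\<open>k\<close> bounds \<open>B\<close> and therefore also \<open>B\<^sup>*\<close>, which makes \<open>X\<close> a contraction\<close>
  have "norm (X x) \<le> norm x" for x
  proof (rule power2_le_imp_le)
    let ?c = "1 / k\<^sup>2"
    have norm_B': "norm (B' y) \<le> k * norm y" for y
    proof (cases "B' y = 0")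
      case False
      have "norm (B' y) * norm (B' y) = inner (B (B' y)) y"
        by (simp add: adj dot_square_norm power2_eq_square)
      also have "\<dots> \<le> norm (B (B' y)) * norm y"
        by (rule norm_cauchy_schwarz)
      also have "\<dots> \<le> norm (B' y) * k * norm y"
        by (intro mult_right_mono k) simp
      finally show ?thesis
        using False by (simp add: mult.assoc mult_left_le_imp_le)
    qed (use \<open>k > 0\<close> in simp)
    have "(norm (X x))\<^sup>2 = (norm x)\<^sup>2 - 2 * ?c * (norm (B x))\<^sup>2 + ?c\<^sup>2 * (norm (B' (B x)))\<^sup>2"
      unfolding X_apply power2_norm_eq_inner adj
      by (simp add: inner_diff_left inner_diff_right inner_commute power2_eq_square)
    also have "\<dots> \<le> (norm x)\<^sup>2 - 2 * ?c * (norm (B x))\<^sup>2 + ?c\<^sup>2 * (k * norm (B x))\<^sup>2"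
      by (intro add_left_mono mult_left_mono power_mono norm_B') auto
    also have "\<dots> = (norm x)\<^sup>2 - ?c * (norm (B x))\<^sup>2"
      using \<open>k > 0\<close> by (simp add: field_simps power2_eq_square)
    also have "\<dots> \<le> (norm x)\<^sup>2"
      by simp
    finally show "(norm (X x))\<^sup>2 \<le> (norm x)\<^sup>2" .
  qed simp
  then have norm_X: "norm X \<le> 1"
    by (intro norm_blinfun_bound) auto
  obtain Y where Y: "Y = (1/2) *\<^sub>R (X + (Y o\<^sub>L Y))"
    and Y_in: "\<And>A. closed A \<Longrightarrow> 0 \<in> A \<Longrightarrow> \<forall>Z\<in>A. (1/2) *\<^sub>R (X + (Z o\<^sub>L Z)) \<in> A \<Longrightarrow> Y \<in> A"
    using sqrt_iteration_limit[OF norm_X] by blast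
  have "Y \<in> cball 0 1"
  proof (rule Y_in)
    show "\<forall>Z\<in>cball 0 1. (1/2) *\<^sub>R (X + (Z o\<^sub>L Z)) \<in> cball 0 1"
    proof
      fix Z :: "'a \<Rightarrow>\<^sub>L 'a" assume Z: "Z \<in> cball 0 1"
      have "norm (X + (Z o\<^sub>L Z)) \<le> norm X + norm Z * norm Z"
        using norm_triangle_ineq[of X "Z o\<^sub>L Z"] norm_blinfun_compose[of Z Z] by linarith
      also have "\<dots> \<le> 1 + 1 * 1"
        using Z norm_X by (intro add_mono mult_mono) auto
      finally show "(1/2) *\<^sub>R (X + (Z o\<^sub>L Z)) \<in> cball 0 1"
        by simp
    qed
  qed auto
  then have norm_Y: "norm (Y x) \<le> norm x" for x
    using norm_blinfun[of Y x] mult_right_mono[of "norm Y" 1 "norm x"] by simp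
  have X_sa: "inner (X x) y = inner x (X y)" for x y
    unfolding X_apply using adj[of x "B y"] adj[of y "B x"]
    by (simp add: inner_diff_left inner_diff_right inner_commute)
  have "Y \<in> {Z :: 'a \<Rightarrow>\<^sub>L 'a. \<forall>x y. inner (Z x) y = inner x (Z y)}"
  proof (rule Y_in)
    show "closed {Z :: 'a \<Rightarrow>\<^sub>L 'a. \<forall>x y. inner (Z x) y = inner x (Z y)}"
      by (intro closed_Collect_all closed_Collect_eq continuous_intros)
  qed (auto simp: blinfun.bilinear_simps inner_add_left inner_add_right X_sa)
  then have Y_sa: "inner (Y x) y = inner x (Y y)" for x y
    by blast
  define S where "S = (\<lambda>x. k *\<^sub>R (x - Y x))"
  show thesis
  proof
    show "bounded_linear S"
      unfolding S_def
      by (intro bounded_linear_const_scaleR bounded_linear_sub bounded_linear_ident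
          blinfun.bounded_linear_right)
    show "\<forall>x y. inner (S x) y = inner x (S y)"
      by (simp add: S_def inner_diff_left inner_diff_right Y_sa)
    show "\<forall>x. inner (S x) x = 0 \<longrightarrow> S x = 0"
    proof (intro allI impI)
      fix x assume "inner (S x) x = 0"
      then have "inner (Y x) x = (norm x)\<^sup>2"
        using \<open>k > 0\<close> by (simp add: S_def inner_diff_left power2_norm_eq_inner)
      then have "(norm (x - Y x))\<^sup>2 = (norm (Y x))\<^sup>2 - (norm x)\<^sup>2"
        by (simp add: power2_norm_eq_inner inner_diff_left inner_diff_right inner_commute)
      also have "\<dots> \<le> 0"
        using norm_Y[of x] by (simp add: power_mono)
      finally show "S x = 0"
        by (simp add: S_def)
    qed
    show "\<forall>x. S (S x) = B' (B x)"
    proof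
      fix x
      have "Y x = (1/2) *\<^sub>R (X x + Y (Y x))"
        by (subst Y) (simp add: blinfun.bilinear_simps)
      then have "2 *\<^sub>R Y x = 2 *\<^sub>R ((1/2) *\<^sub>R (X x + Y (Y x)))"
        by simp
      then have "2 *\<^sub>R Y x = x - (1 / k\<^sup>2) *\<^sub>R B' (B x) + Y (Y x)"
        by (simp only: scaleR_scaleR X_apply) simp
      then have "x - 2 *\<^sub>R Y x + Y (Y x) = (1 / k\<^sup>2) *\<^sub>R B' (B x)"
        by (simp add: algebra_simps)
      moreover have "S (S x) = k\<^sup>2 *\<^sub>R (x - 2 *\<^sub>R Y x + Y (Y x))"
        by (simp add: S_def blinfun.bilinear_simps algebra_simps power2_eq_square scaleR_2)
      ultimately show "S (S x) = B' (B x)"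
        using \<open>k > 0\<close> by simp
    qed
    show "\<forall>C. bounded_linear C \<longrightarrow> (\<forall>x. C (B' (B x)) = B' (B (C x))) \<longrightarrow> (\<forall>x. C (S x) = S (C x))"
    proof (intro allI impI)
      fix C x
      assume C: "bounded_linear C" and comm: "\<forall>x. C (B' (B x)) = B' (B (C x))"
      interpret C: bounded_linear C by (rule C)
      have "Y \<in> {Z :: 'a \<Rightarrow>\<^sub>L 'a. \<forall>x. C (Z x) = Z (C x)}"
      proof (rule Y_in)
        show "closed {Z :: 'a \<Rightarrow>\<^sub>L 'a. \<forall>x. C (Z x) = Z (C x)}"
          by (intro closed_Collect_all closed_Collect_eq continuous_intros
              C.continuous_on)
      qed (auto simp: blinfun.bilinear_simps C.add C.diff C.scaleR C.zero X_apply comm)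
      then show "C (S x) = S (C x)"
        by (simp add: S_def C.scaleR C.diff)
    qed
  qed
qed

section \<open>Schur's lemma for self-adjoint operators\<close>

text \<open>
  The scalar can only be the value \<open>a\<close> of the normalised quadratic form at any nonzero vector \<open>v\<close>.
  With \<open>B = T - a\<close>, the absence of zero divisors turns \<open>\<bar>B\<bar>\<^sup>2 = B\<^sup>2\<close> into \<open>B = \<plusminus>\<bar>B\<bar>\<close>; then
  \<open>\<langle>B v, v\<rangle> = 0\<close> puts \<open>v\<close> into the kernel of \<open>B\<close>, which by irreducibility is everything.
\<close>

lemma selfadjoint_commuting_imp_scalar:
  fixes T :: "'a::{real_inner,banach} \<Rightarrow> 'a"
  assumes G: "\<And>C. C \<in> G \<Longrightarrow> bounded_linear C"
    and irr: "\<And>M. closed M \<Longrightarrow> subspace M \<Longrightarrow> (\<And>C. C \<in> G \<Longrightarrow> C ` M \<subseteq> M) \<Longrightarrow> M = {0} \<or> M = UNIV"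
    and T: "bounded_linear T" and sa: "\<And>x y. inner (T x) y = inner x (T y)"
    and comm: "\<And>C x. C \<in> G \<Longrightarrow> C (T x) = T (C x)"
  shows "\<exists>a. \<forall>x. T x = a *\<^sub>R x"
proof (cases "\<forall>x::'a. x = 0")
  case True
  then show ?thesis
    by metis
next
  case False
  then obtain v :: 'a where v: "v \<noteq> 0"
    by blast
  interpret T: bounded_linear T by (rule T)
  \<comment> \<open>an operator in the commutant with nontrivial kernel vanishes\<close>
  have kernel: "A x = 0"
    if A: "bounded_linear A" and AC: "\<And>C x. C \<in> G \<Longrightarrow> C (A x) = A (C x)"
      and "A w = 0" "w \<noteq> 0" for A :: "'a \<Rightarrow> 'a" and w x
  proof -
    interpret A: bounded_linear A by (rule A)
    have "closed {x. A x = 0}"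
      by (intro closed_Collect_eq continuous_intros A.continuous_on)
    moreover have "subspace {x. A x = 0}"
      by (auto simp: subspace_def A.zero A.add A.scaleR)
    moreover have "C ` {x. A x = 0} \<subseteq> {x. A x = 0}" if "C \<in> G" for C
      using AC[OF that] linear_0[OF bounded_linear.linear[OF G[OF that]]] by (auto simp flip: AC[OF that])
    ultimately have "{x. A x = 0} = {0} \<or> {x. A x = 0} = UNIV"
      by (rule irr)
    then show ?thesis
      using that(3,4) by blast
  qed
  define a where "a = inner (T v) v / inner v v"
  define B where "B = (\<lambda>x. T x - a *\<^sub>R x)"
  have B: "bounded_linear B"
    unfolding B_def
    by (intro bounded_linear_sub T bounded_linear_scaleR_right)
  interpret B: bounded_linear B by (rule B)
  have B_sa: "inner (B x) y = inner x (B y)" for x y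
    by (simp add: B_def inner_diff_left inner_diff_right sa)
  have BC: "C (B x) = B (C x)" if "C \<in> G" for C x
  proof -
    interpret C: bounded_linear C by (rule G[OF that])
    show ?thesis
      by (simp add: B_def C.diff C.scaleR comm[OF that])
  qed
  obtain S where S: "bounded_linear S"
    and "\<forall>x y. inner (S x) y = inner x (S y)"
    and S_pos: "\<forall>x. inner (S x) x = 0 \<longrightarrow> S x = 0"
    and SS: "\<forall>x. S (S x) = B (B x)"
    and S_comm: "\<forall>C. bounded_linear C \<longrightarrow> (\<forall>x. C (B (B x)) = B (B (C x))) \<longrightarrow> (\<forall>x. C (S x) = S (C x))"
    by (rule absolute_value_exists[OF B B B_sa])
  interpret S: bounded_linear S by (rule S)
  have SC: "C (S x) = S (C x)" if "C \<in> G" for C x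
    using S_comm G[OF that] BC[OF that] by simp
  have BS: "B (S x) = S (B x)" for x
    using S_comm B by simp
  have "\<exists>s::real. s \<noteq> 0 \<and> (\<forall>x. B x = s *\<^sub>R S x)"
  proof (cases "\<forall>x. S x + B x = 0")
    case True
    then show ?thesis
      by (intro exI[of _ "-1"]) (simp add: add_eq_0_iff)
  next
    case False
    then obtain u where u: "S u + B u \<noteq> 0"
      by blast
    \<comment> \<open>\<open>(S - B) (S + B) = S\<^sup>2 - B\<^sup>2 = 0\<close>, so the range of \<open>S + B\<close> lies in the kernel of \<open>S - B\<close>\<close>
    have "S x - B x = 0" for x
    proof (rule kernel[where A = "\<lambda>x. S x - B x" and w = "S u + B u"])
      show "S (S u + B u) - B (S u + B u) = 0"
        by (simp add: S.add B.add SS BS)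
      show "C (S x - B x) = S (C x) - B (C x)" if "C \<in> G" for C x
        using that G[OF that] by (simp add: SC BC linear_diff bounded_linear.linear)
    qed (use u S B bounded_linear_sub in auto)
    then show ?thesis
      by (intro exI[of _ 1]) simp
  qed
  then obtain s :: real where "s \<noteq> 0" and s: "\<And>x. B x = s *\<^sub>R S x"
    by blast
  have "inner (B v) v = 0"
    using v by (simp add: B_def a_def inner_diff_left)
  then have "S v = 0"
    using s \<open>s \<noteq> 0\<close> S_pos by simp
  then have "B x = 0" for x
    using kernel[OF B BC _ v] s by simp
  then show ?thesis
    by (auto simp: B_def)
qed

section \<open>Complex structure as a real operator\<close>

lemma cinner_scaleC_right: "cinner x (c *\<^sub>C y) = cnj c * cinner x y"
  by (metis cinner_commute cinner_scaleC_left complex_cnj_mult)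

lemma norm_scaleC: "norm (c *\<^sub>C x) = cmod c * norm x"
  for x :: "'a::complex_hilbert_space"
proof (rule power2_eq_imp_eq)
  have "(norm (c *\<^sub>C x))\<^sup>2 = Re ((c * cnj c) * cinner x x)"
    by (simp add: power2_norm_eq_inner inner_eq_Re_cinner cinner_scaleC_left cinner_scaleC_right
        algebra_simps)
  also have "\<dots> = (cmod c)\<^sup>2 * (norm x)\<^sup>2"
    by (simp only: complex_norm_square[symmetric])
      (simp add: power2_norm_eq_inner inner_eq_Re_cinner flip: of_real_power)
  finally show "(norm (c *\<^sub>C x))\<^sup>2 = (cmod c * norm x)\<^sup>2"
    by (simp add: power_mult_distrib)
qed auto

lemma bounded_linear_scaleC: "bounded_linear (scaleC c :: 'a::complex_hilbert_space \<Rightarrow> 'a)"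
  by (rule bounded_linear_intro[where K = "cmod c"])
    (simp_all add: scaleC_add_right scaleR_scaleC scaleC_scaleC mult.commute norm_scaleC)

lemma inner_ii_left: "inner (\<i> *\<^sub>C x) y = - inner x (\<i> *\<^sub>C y)"
  for x :: "'a::complex_hilbert_space"
  by (simp add: inner_eq_Re_cinner cinner_scaleC_left cinner_scaleC_right)

lemma cinner_eq_Complex_inner: "cinner x y = Complex (inner x y) (inner x (\<i> *\<^sub>C y))"
  by (simp add: inner_eq_Re_cinner cinner_scaleC_right)

lemma scaleC_eq_real_combination: "c *\<^sub>C x = Re c *\<^sub>R x + Im c *\<^sub>R \<i> *\<^sub>C x"
proof -
  have "c = complex_of_real (Re c) + complex_of_real (Im c) * \<i>"
    by (simp add: complex_eq_iff)
  then show ?thesis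
    by (metis scaleC_add_left scaleC_scaleC scaleR_scaleC)
qed

lemma bounded_clinear_iff_commutes_ii:
  "bounded_clinear f \<longleftrightarrow> bounded_linear f \<and> (\<forall>x. f (\<i> *\<^sub>C x) = \<i> *\<^sub>C f x)"
proof safe
  assume f: "bounded_linear f" and ii: "\<forall>x. f (\<i> *\<^sub>C x) = \<i> *\<^sub>C f x"
  interpret bounded_linear f by (rule f)
  have "f (c *\<^sub>C x) = c *\<^sub>C f x" for c x
    unfolding scaleC_eq_real_combination[of c] by (simp add: add scaleR ii)
  with f show "bounded_clinear f"
    by (simp add: bounded_clinear_def)
qed (simp_all add: bounded_clinear_def)

lemma csubspace_iff_ii_invariant:
  "complex_vector.subspace M \<longleftrightarrow> subspace M \<and> scaleC \<i> ` M \<subseteq> M"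
proof safe
  assume M: "complex_vector.subspace M"
  then show "subspace M"
    by (simp add: subspace_def complex_vector.subspace_def scaleR_scaleC)
  show "\<i> *\<^sub>C x \<in> M" if "x \<in> M" for x
    using M that by (rule complex_vector.subspace_scale)
next
  assume M: "subspace M" and ii: "scaleC \<i> ` M \<subseteq> M"
  have "c *\<^sub>C x \<in> M" if "x \<in> M" for c x
    unfolding scaleC_eq_real_combination[of c]
    using M ii that by (auto intro!: subspace_add subspace_scale)
  then show "complex_vector.subspace M"
    using M by (simp add: complex_vector.subspace_def subspace_add subspace_0)
qed

text \<open>
  This is the adjoint of \<open>R A = B R\<close>.
\<close>

lemma adjoint_intertwines:
  fixes R :: "'a::real_inner \<Rightarrow> 'b::real_inner"
  assumes R': "\<And>x y. inner (R x) y = inner x (R' y)"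
    and A': "\<And>x y. inner (A x) y = inner x (A' y)"
    and B': "\<And>x y. inner (B x) y = inner x (B' y)"
    and RA: "\<And>x. R (A x) = B (R x)"
  shows "R' (B' y) = A' (R' y)"
proof -
  have "inner x (R' (B' y)) = inner x (A' (R' y))" for x
    by (metis R' A' B' RA)
  then show ?thesis
    using vector_eq_ldot by blast
qed

text \<open>
  Multiplication by \<open>\<i>\<close> is skew-adjoint for the real inner product, and the two signs cancel; so the
  real adjoint of a complex linear map is complex linear.
\<close>

lemma adjoint_commutes_ii:
  fixes R :: "'a::complex_hilbert_space \<Rightarrow> 'b::complex_hilbert_space"
  assumes R': "\<And>x y. inner (R x) y = inner x (R' y)"
    and ii: "\<And>x. R (\<i> *\<^sub>C x) = \<i> *\<^sub>C R x"
  shows "R' (\<i> *\<^sub>C y) = \<i> *\<^sub>C R' y"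
proof -
  have "inner x (R' (\<i> *\<^sub>C y)) = inner x (\<i> *\<^sub>C R' y)" for x
    using inner_ii_left[of "R x" y] inner_ii_left[of x "R' y"] R'[of "\<i> *\<^sub>C x" y]
      R'[of x "\<i> *\<^sub>C y"] by (simp add: ii)
  then show ?thesis
    using vector_eq_ldot by blast
qed

section \<open>Schur's lemma for families of projections\<close>

lemma orthogonal_projectionD:
  assumes "orthogonal_projection P"
  shows "bounded_linear P" "P (\<i> *\<^sub>C x) = \<i> *\<^sub>C P x" "P (P x) = P x"
    "inner (P x) y = inner x (P y)"
  using assms
  by (auto simp: orthogonal_projection_def bounded_clinear_def fun_eq_iff inner_eq_Re_cinner)

text \<open>
  The real and imaginary parts of \<open>R\<close> are self-adjoint and, because the projections are, commute
  with the family. Adding multiplication by \<open>\<i>\<close> to the family reduces the claim to the real version: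
  a real subspace invariant under the enlarged family is a complex subspace.
\<close>

lemma irreducible_imp_commutant_scalar:
  fixes R :: "'a::complex_hilbert_space \<Rightarrow> 'a"
  assumes proj: "\<And>P. P \<in> set Ps \<Longrightarrow> orthogonal_projection P"
    and irr: "irreducible_projections Ps"
    and R: "bounded_clinear R" and comm: "\<And>P. P \<in> set Ps \<Longrightarrow> R \<circ> P = P \<circ> R"
  shows "\<exists>c. R = (\<lambda>x. c *\<^sub>C x)"
proof -
  have Rbl: "bounded_linear R" and Rii: "R (\<i> *\<^sub>C x) = \<i> *\<^sub>C R x" for x
    using R by (auto simp: bounded_clinear_iff_commutes_ii)
  interpret R: bounded_linear R by (rule Rbl)
  have RP: "R (P x) = P (R x)" if "P \<in> set Ps" for P x
    using comm[OF that] by (simp add: fun_eq_iff)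
  obtain R' where R'bl: "bounded_linear R'" and R': "\<And>x y. inner (R x) y = inner x (R' y)"
    using adjoint_exists[OF Rbl] by blast
  interpret R': bounded_linear R' by (rule R'bl)
  have R'_left: "inner (R' x) y = inner x (R y)" for x y
    using R'[of y x] by (simp add: inner_commute)
  interpret ii: bounded_linear "scaleC \<i> :: 'a \<Rightarrow> 'a" by (rule bounded_linear_scaleC)
  have R'ii: "R' (\<i> *\<^sub>C y) = \<i> *\<^sub>C R' y" for y
    by (rule adjoint_commutes_ii[OF R' Rii])
  have R'P: "R' (P x) = P (R' x)" if "P \<in> set Ps" for P x
    by (rule adjoint_intertwines[OF R' orthogonal_projectionD(4)[OF proj[OF that]]
          orthogonal_projectionD(4)[OF proj[OF that]] RP[OF that]])
  let ?G = "insert (scaleC \<i>) (set Ps)"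
  have scalar: "\<exists>a. \<forall>x. T x = a *\<^sub>R x"
    if T: "bounded_linear T" and sa: "\<And>x y. inner (T x) y = inner x (T y)"
      and TC: "\<And>C x. C \<in> ?G \<Longrightarrow> C (T x) = T (C x)" for T :: "'a \<Rightarrow> 'a"
  proof (rule selfadjoint_commuting_imp_scalar[of ?G])
    show "bounded_linear C" if "C \<in> ?G" for C
      using that proj orthogonal_projectionD(1) bounded_linear_scaleC by auto
    show "M = {0} \<or> M = UNIV"
      if "closed M" "subspace M" and inv: "\<And>C. C \<in> ?G \<Longrightarrow> C ` M \<subseteq> M" for M
    proof -
      have "closed_csubspace M"
        using that by (simp add: closed_csubspace_def csubspace_iff_ii_invariant)
      then show ?thesis
        using irr inv by (simp add: irreducible_projections_def)
    qed
  qed (fact that)+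
  have "\<exists>a. \<forall>x. R x + R' x = a *\<^sub>R x"
  proof (rule scalar)
    show "C (R x + R' x) = R (C x) + R' (C x)" if "C \<in> ?G" for C x
    proof -
      interpret C: bounded_linear C
        using that proj orthogonal_projectionD(1) bounded_linear_scaleC by auto
      show ?thesis
        using that by (auto simp: C.add Rii R'ii RP R'P scaleC_add_right)
    qed
    show "inner (R x + R' x) y = inner x (R y + R' y)" for x y
      by (simp add: inner_add_left inner_add_right R' R'_left)
  qed (intro bounded_linear_add Rbl R'bl)
  then obtain a where a: "\<And>x. R x + R' x = a *\<^sub>R x"
    by blast
  \<comment> \<open>\<open>R - R\<^sup>*\<close> is skew-adjoint and becomes self-adjoint after multiplication by \<open>\<i>\<close>\<close>
  have "\<exists>b. \<forall>x. \<i> *\<^sub>C (R x - R' x) = b *\<^sub>R x"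
  proof (rule scalar)
    show "C (\<i> *\<^sub>C (R x - R' x)) = \<i> *\<^sub>C (R (C x) - R' (C x))" if "C \<in> ?G" for C x
    proof -
      interpret C: bounded_linear C
        using that proj orthogonal_projectionD(1) bounded_linear_scaleC by auto
      have "C (\<i> *\<^sub>C z) = \<i> *\<^sub>C C z" for z
        using that proj orthogonal_projectionD(2) by auto
      then show ?thesis
        using that by (auto simp: C.diff Rii R'ii RP R'P ii.diff)
    qed
    show "inner (\<i> *\<^sub>C (R x - R' x)) y = inner x (\<i> *\<^sub>C (R y - R' y))" for x y
      by (simp add: inner_ii_left inner_diff_left inner_diff_right ii.diff R' R'_left Rii R'ii)
  qed (intro bounded_linear_compose[OF bounded_linear_scaleC] bounded_linear_sub Rbl R'bl)
  then obtain b where b: "\<And>x. \<i> *\<^sub>C (R x - R' x) = b *\<^sub>R x"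
    by blast
  have "R x = Complex (a / 2) (- b / 2) *\<^sub>C x" for x
  proof -
    have "R x - R' x = - (\<i> *\<^sub>C \<i> *\<^sub>C (R x - R' x))"
      by (simp add: scaleC_scaleC)
    also have "\<dots> = - (b *\<^sub>R \<i> *\<^sub>C x)"
      by (simp add: b ii.scaleR)
    finally have "2 *\<^sub>R R x = a *\<^sub>R x - b *\<^sub>R \<i> *\<^sub>C x"
      using a[of x] by (simp add: scaleR_2 algebra_simps)
    then have "(1/2) *\<^sub>R 2 *\<^sub>R R x = (1/2) *\<^sub>R (a *\<^sub>R x - b *\<^sub>R \<i> *\<^sub>C x)"
      by simp
    then show ?thesis
      unfolding scaleC_eq_real_combination[of "Complex _ _"] by (simp add: scaleR_diff_right)
  qed
  then show ?thesis
    by (intro exI ext)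
qed

text \<open>
  The orthogonal projection \<open>E\<close> onto an invariant subspace commutes with the family, because
  self-adjoint operators leave the orthogonal complement invariant as well. The uniqueness of
  the orthogonal decomposition gives linearity and all the commutation relations of \<open>E\<close>.
\<close>

lemma commutant_scalar_imp_irreducible:
  fixes Ps :: "('a::complex_hilbert_space \<Rightarrow> 'a) list"
  assumes proj: "\<And>P. P \<in> set Ps \<Longrightarrow> orthogonal_projection P"
    and scalar: "\<And>R. bounded_clinear R \<Longrightarrow> \<forall>P\<in>set Ps. R \<circ> P = P \<circ> R \<Longrightarrow> \<exists>c. R = (\<lambda>x. c *\<^sub>C x)"
  shows "irreducible_projections Ps"
  unfolding irreducible_projections_def
proof (intro allI impI, elim conjE)
  fix M :: "'a set"
  assume M: "closed_csubspace M" and inv: "\<forall>P\<in>set Ps. P ` M \<subseteq> M"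
  have cl: "closed M" and sub: "subspace M" and ii: "scaleC \<i> ` M \<subseteq> M"
    using M by (auto simp: closed_csubspace_def csubspace_iff_ii_invariant)
  obtain E where EM: "\<And>x. E x \<in> M" and E_orth: "\<And>x y. y \<in> M \<Longrightarrow> inner (x - E x) y = 0"
    using orthogonal_decomposition[OF cl sub] by metis
  have E_unique: "E x = z" if "z \<in> M" and "\<And>y. y \<in> M \<Longrightarrow> inner (x - z) y = 0" for x z
  proof -
    have "E x - z \<in> M"
      using EM that(1) sub by (simp add: subspace_diff)
    then have "inner (x - z) (E x - z) - inner (x - E x) (E x - z) = 0"
      using that(2) E_orth by simp
    then show ?thesis
      by (simp flip: inner_diff_left)
  qed
  have E_commutes: "E (C x) = C (E x)"
    if C: "linear C" and CM: "C ` M \<subseteq> M" and adj: "\<And>x y. inner (C x) y = inner x (C' y)"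
      and C'M: "C' ` M \<subseteq> M" for C C' x
  proof (rule E_unique)
    show "C (E x) \<in> M"
      using EM CM by blast
    show "inner (C x - C (E x)) y = 0" if "y \<in> M" for y
      using adj[of "x - E x" y] E_orth[of "C' y" x] C'M that by (auto simp: linear_diff[OF C])
  qed
  have Ebl: "bounded_linear E"
  proof (rule bounded_linear_intro)
    show "E (x + y) = E x + E y" for x y
    proof (rule E_unique)
      show "E x + E y \<in> M"
        using EM sub by (simp add: subspace_add)
      show "inner (x + y - (E x + E y)) v = 0" if "v \<in> M" for v
        using E_orth[OF that, of x] E_orth[OF that, of y]
        by (simp add: inner_diff_left inner_add_left)
    qed
    show "E (r *\<^sub>R x) = r *\<^sub>R E x" for r x
    proof (rule E_unique)
      show "r *\<^sub>R E x \<in> M"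
        using EM sub by (simp add: subspace_scale)
      show "inner (r *\<^sub>R x - r *\<^sub>R E x) v = 0" if "v \<in> M" for v
        using E_orth[OF that, of x] by (simp flip: scaleR_diff_right)
    qed
    show "norm (E x) \<le> norm x * 1" for x
    proof (cases "E x = 0")
      case False
      have "norm (E x) * norm (E x) = inner x (E x)"
        using E_orth[OF EM, of x x] by (simp add: inner_diff_left dot_square_norm power2_eq_square)
      also have "\<dots> \<le> norm x * norm (E x)"
        by (rule norm_cauchy_schwarz)
      finally show ?thesis
        using False by simp
    qed simp
  qed
  have "E (\<i> *\<^sub>C x) = \<i> *\<^sub>C E x" for x
  proof (rule E_commutes[where C' = "\<lambda>x. - (\<i> *\<^sub>C x)"])
    show "linear (scaleC \<i> :: 'a \<Rightarrow> 'a)"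
      by (rule bounded_linear.linear[OF bounded_linear_scaleC])
    show "(\<lambda>x. - (\<i> *\<^sub>C x)) ` M \<subseteq> M"
      using ii sub by (auto intro!: subspace_neg)
  qed (use ii inner_ii_left in auto)
  then have "bounded_clinear E"
    using Ebl by (simp add: bounded_clinear_iff_commutes_ii)
  moreover have "E \<circ> P = P \<circ> E" if "P \<in> set Ps" for P
    using E_commutes[of P P] orthogonal_projectionD(1,4)[OF proj[OF that]] inv that
    by (auto simp: fun_eq_iff bounded_linear.linear)
  ultimately obtain c where c: "E = (\<lambda>x. c *\<^sub>C x)"
    using scalar by blast
  have E_id: "E x = x" if "x \<in> M" for x
    using that by (rule E_unique) simp
  show "M = {0} \<or> M = UNIV"
  proof (cases "c = 0")
    case True
    then have "x = 0" if "x \<in> M" for x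
      using E_id[OF that] c by simp
    then show ?thesis
      using subspace_0[OF sub] by blast
  next
    case False
    then have "E (inverse c *\<^sub>C x) = x" for x
      using c by (simp add: scaleC_scaleC scaleC_one)
    then show ?thesis
      using EM by (metis UNIV_eq_I)
  qed
qed

section \<open>Maps between systems of five subspaces\<close>

lemma mutually_orthogonal_sym:
  assumes "orthogonal_projection P" "orthogonal_projection Q" "mutually_orthogonal P Q"
  shows "mutually_orthogonal Q P"
proof -
  have "Q (P x) = 0" for x
  proof -
    have "inner (Q (P x)) (Q (P x)) = inner x (P (Q (Q (P x))))"
      by (simp only: orthogonal_projectionD(4)[OF assms(1)] orthogonal_projectionD(4)[OF assms(2)])
    also have "\<dots> = 0"
      using assms(3) by (simp add: mutually_orthogonal_def fun_eq_iff)
    finally show ?thesis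
      by simp
  qed
  then show ?thesis
    by (simp add: mutually_orthogonal_def fun_eq_iff)
qed

text \<open>
  Decompose \<open>x\<close> along the summands of the source. The summands are mapped into the corresponding
  summands of the target, so the components of \<open>R x\<close> are the images of the components of \<open>x\<close>.
\<close>

lemma maps_five_subspaces_iff_intertwines:
  assumes R: "linear R"
    and P: "orthogonal_projection P1" "orthogonal_projection P2" "orthogonal_projection P3"
    and Q: "orthogonal_projection Q1" "orthogonal_projection Q2" "orthogonal_projection Q3"
      "mutually_orthogonal Q2 Q3"
  shows "list_all2 (\<lambda>K L. R ` K \<subseteq> L) (five_subspaces P1 P2 P3) (five_subspaces Q1 Q2 Q3) \<longleftrightarrow>
    list_all2 (\<lambda>P Q. R \<circ> P = Q \<circ> R) [P1, P2, P3] [Q1, Q2, Q3]"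
proof
  note linQ = Q(1-3)[THEN orthogonal_projectionD(1), THEN bounded_linear.linear]
  note diff = linear_diff[OF R] linQ[THEN linear_diff]
  note add = linear_add[OF R] linQ[THEN linear_add]
  note idem = Q(1-3)[THEN orthogonal_projectionD(3)]
  have Q23: "Q2 (Q3 y) = 0" "Q3 (Q2 y) = 0" for y
    using Q(4) mutually_orthogonal_sym[OF Q(2-4)]
    by (simp_all add: mutually_orthogonal_def fun_eq_iff)
  assume "list_all2 (\<lambda>K L. R ` K \<subseteq> L) (five_subspaces P1 P2 P3) (five_subspaces Q1 Q2 Q3)"
  then have sub: "R ` range P1 \<subseteq> range Q1" "R ` range (proj_compl P1) \<subseteq> range (proj_compl Q1)"
      "R ` range P2 \<subseteq> range Q2" "R ` range P3 \<subseteq> range Q3"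
      "R ` range (proj_compl (\<lambda>x. P2 x + P3 x)) \<subseteq> range (proj_compl (\<lambda>x. Q2 x + Q3 x))"
    by (simp_all add: five_subspaces_def)
  have "R (P1 x) = Q1 (R x)" for x
  proof -
    obtain u where u: "R (P1 x) = Q1 u"
      using sub(1) by blast
    obtain v where v: "R (x - P1 x) = v - Q1 v"
      using sub(2) unfolding proj_compl_def by blast
    have "Q1 (R (P1 x) + R (x - P1 x)) = R (P1 x)"
      unfolding u v by (simp add: add diff idem)
    then show ?thesis
      by (simp flip: add)
  qed
  moreover have "R (P2 x) = Q2 (R x) \<and> R (P3 x) = Q3 (R x)" for x
  proof -
    obtain u where u: "R (P2 x) = Q2 u"
      using sub(3) by blast
    obtain v where v: "R (P3 x) = Q3 v"
      using sub(4) by blast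
    obtain w where w: "R (x - (P2 x + P3 x)) = w - (Q2 w + Q3 w)"
      using sub(5) unfolding proj_compl_def by blast
    have "R x = R (P2 x) + R (P3 x) + R (x - (P2 x + P3 x))"
      by (simp flip: add)
    then have "R x = Q2 u + Q3 v + (w - (Q2 w + Q3 w))"
      unfolding u v w .
    then show ?thesis
      unfolding u v by (simp add: add diff idem Q23)
  qed
  ultimately show "list_all2 (\<lambda>P Q. R \<circ> P = Q \<circ> R) [P1, P2, P3] [Q1, Q2, Q3]"
    by (simp add: fun_eq_iff)
next
  assume "list_all2 (\<lambda>P Q. R \<circ> P = Q \<circ> R) [P1, P2, P3] [Q1, Q2, Q3]"
  then show "list_all2 (\<lambda>K L. R ` K \<subseteq> L) (five_subspaces P1 P2 P3) (five_subspaces Q1 Q2 Q3)"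
    by (auto simp: five_subspaces_def proj_compl_def fun_eq_iff linear_diff[OF R] linear_add[OF R])
qed

section \<open>Polar decomposition of an isomorphism\<close>

text \<open>
  Put \<open>S = \<bar>R\<bar>\<close>. From \<open>\<parallel>S x\<parallel> = \<parallel>R x\<parallel>\<close>, the map \<open>S x \<mapsto> R x\<close> is an isometry of the range of \<open>S\<close> onto the
  target space; the latter being complete, the range of \<open>S\<close> is closed, and it is dense since
  \<open>S\<close> is self-adjoint and injective. Hence \<open>S\<close> is bijective and \<open>W = R S\<^sup>-\<^sup>1\<close> is unitary. One \<open>W\<close> serves all intertwined pairs of
  projections at once.
\<close>

lemma bijective_intertwiner_imp_unitary_intertwiner:
  fixes R :: "'a::complex_hilbert_space \<Rightarrow> 'b::complex_hilbert_space"
  assumes R: "bounded_clinear R" and "bij R"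
  shows "\<exists>W. unitary_map W \<and> (\<forall>P Q. orthogonal_projection P \<longrightarrow> orthogonal_projection Q \<longrightarrow>
    R \<circ> P = Q \<circ> R \<longrightarrow> W \<circ> P = Q \<circ> W)"
proof -
  have Rbl: "bounded_linear R" and Rii: "R (\<i> *\<^sub>C x) = \<i> *\<^sub>C R x" for x
    using R by (auto simp: bounded_clinear_iff_commutes_ii)
  interpret R: bounded_linear R by (rule Rbl)
  obtain R' where R'bl: "bounded_linear R'" and R': "\<And>x y. inner (R x) y = inner x (R' y)"
    using adjoint_exists[OF Rbl] by blast
  interpret R': bounded_linear R' by (rule R'bl)
  have R'ii: "R' (\<i> *\<^sub>C y) = \<i> *\<^sub>C R' y" for y
    by (rule adjoint_commutes_ii[OF R' Rii])
  obtain S where Sbl: "bounded_linear S"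
    and S_sa: "\<forall>x y. inner (S x) y = inner x (S y)"
    and S_pos: "\<forall>x. inner (S x) x = 0 \<longrightarrow> S x = 0"
    and SS: "\<forall>x. S (S x) = R' (R x)"
    and S_comm: "\<forall>C. bounded_linear C \<longrightarrow> (\<forall>x. C (R' (R x)) = R' (R (C x))) \<longrightarrow> (\<forall>x. C (S x) = S (C x))"
    by (rule absolute_value_exists[OF Rbl R'bl R'])
  interpret S: bounded_linear S by (rule Sbl)
  have inner_S: "inner (S x) (S y) = inner (R x) (R y)" for x y
    by (simp add: S_sa SS R')
  then have norm_S: "norm (S x) = norm (R x)" for x
    by (simp add: norm_eq_sqrt_inner)
  have R_eq_0: "x = 0" if "R x = 0" for x
    using bij_is_inj[OF \<open>bij R\<close>] that R.zero by (metis injD)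
  have S_inj: "inj S"
  proof (rule injI)
    fix x y assume "S x = S y"
    then have "R (x - y) = 0"
      using norm_S[of "x - y"] by (simp add: S.diff)
    then show "x = y"
      using R_eq_0[of "x - y"] by simp
  qed
  have "closed (range S)"
    unfolding closed_sequential_limits
  proof (intro allI impI, elim conjE)
    fix s l assume "\<forall>n. s n \<in> range S" and l: "s \<longlonglongrightarrow> l"
    then obtain u where u: "s = (\<lambda>n. S (u n))"
      by (metis image_iff ext)
    have "dist (R (u m)) (R (u n)) = dist (s m) (s n)" for m n
      using norm_S[of "u m - u n"] by (simp add: u dist_norm R.diff S.diff)
    then have "Cauchy (\<lambda>n. R (u n))"
      using LIMSEQ_imp_Cauchy[OF l] by (simp add: Cauchy_def)
    then obtain z where z: "(\<lambda>n. R (u n)) \<longlonglongrightarrow> z"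
      by (meson Cauchy_convergent_iff convergentD)
    obtain x where x: "z = R x"
      using bij_is_surj[OF \<open>bij R\<close>] by blast
    have "dist (R (u n)) (R x) = dist (s n) (S x)" for n
      using norm_S[of "u n - x"] by (simp add: u dist_norm R.diff S.diff)
    moreover have "(\<lambda>n. dist (R (u n)) (R x)) \<longlonglongrightarrow> 0"
      using z unfolding x by (rule tendsto_dist_iff[THEN iffD1])
    ultimately have "(\<lambda>n. dist (s n) (S x)) \<longlonglongrightarrow> 0"
      by simp
    then have "s \<longlonglongrightarrow> S x"
      by (rule tendsto_dist_iff[THEN iffD2])
    then show "l \<in> range S"
      using LIMSEQ_unique[OF l] by blast
  qed
  moreover have "subspace (range S)"
    using subspace_UNIV by (rule linear_subspace_image[OF S.linear])
  ultimately have decomp: "\<exists>z\<in>range S. \<forall>y\<in>range S. inner (x - z) y = 0" for x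
    by (rule orthogonal_decomposition)
  have "x \<in> range S" for x
  proof -
    obtain z where "z \<in> range S" and z: "\<And>y. inner (x - z) (S y) = 0"
      using decomp[of x] by blast
    have "inner (S (x - z)) (S (x - z)) = 0"
      using z[of "S (x - z)"] by (simp add: S_sa)
    then have "S (x - z) = S 0"
      by (simp add: S.zero)
    then have "x = z"
      using injD[OF S_inj] by fastforce
    with \<open>z \<in> range S\<close> show ?thesis
      by simp
  qed
  then have S_ex: "\<exists>x. y = S x" for y
    by blast
  define W where "W = R \<circ> inv S"
  have WS: "W (S x) = R x" for x
    by (simp add: W_def S_inj)
  have S_ii: "S (\<i> *\<^sub>C x) = \<i> *\<^sub>C S x" for x
    using S_comm[rule_format, OF bounded_linear_scaleC[of \<i>], of x] by (simp add: Rii R'ii)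
  have W_inner: "inner (W x) (W y) = inner x y" for x y
    using S_ex[of x] S_ex[of y] by (auto simp: WS inner_S)
  have W_ii: "W (\<i> *\<^sub>C x) = \<i> *\<^sub>C W x" for x
    using S_ex[of x] by (auto simp: WS Rii simp flip: S_ii)
  have "bounded_linear W"
  proof (rule bounded_linear_intro)
    show "W (x + y) = W x + W y" for x y
      using S_ex[of x] S_ex[of y] by (auto simp: WS R.add simp flip: S.add)
    show "W (r *\<^sub>R x) = r *\<^sub>R W x" for r x
      using S_ex[of x] by (auto simp: WS R.scaleR simp flip: S.scaleR)
    show "norm (W x) \<le> norm x * 1" for x
      by (simp add: norm_eq_sqrt_inner W_inner)
  qed
  then have "bounded_clinear W"
    by (simp add: bounded_clinear_iff_commutes_ii W_ii)
  moreover have "surj W"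
    using WS bij_is_surj[OF \<open>bij R\<close>] by (metis surj_def)
  moreover have "cinner (W x) (W y) = cinner x y" for x y
    by (simp add: cinner_eq_Complex_inner W_inner flip: W_ii)
  ultimately have "unitary_map W"
    by (simp add: unitary_map_def)
  moreover have "W \<circ> P = Q \<circ> W"
    if P: "orthogonal_projection P" and Q: "orthogonal_projection Q" and "R \<circ> P = Q \<circ> R" for P Q
  proof -
    have RP: "R (P x) = Q (R x)" for x
      using that(3) by (simp add: fun_eq_iff)
    \<comment> \<open>the adjoint relation makes \<open>P\<close> commute with \<open>R\<^sup>*R\<close> and hence with \<open>S\<close>\<close>
    have "R' (Q y) = P (R' y)" for y
      by (rule adjoint_intertwines[OF R' orthogonal_projectionD(4)[OF P]
            orthogonal_projectionD(4)[OF Q] RP])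
    then have SP: "P (S x) = S (P x)" for x
      using S_comm orthogonal_projectionD(1)[OF P] RP by simp
    have "W (P y) = Q (W y)" for y
      using S_ex[of y] by (auto simp: SP WS RP)
    then show ?thesis
      by (simp add: fun_eq_iff)
  qed
  ultimately show ?thesis
    by blast
qed

lemma unitary_map_bij:
  assumes "unitary_map W"
  shows "bij W"
proof -
  interpret W: bounded_linear W
    using assms by (simp add: unitary_map_def bounded_clinear_def)
  have "inj W"
  proof (rule injI)
    fix x y assume "W x = W y"
    then have "cinner (W (x - y)) (W (x - y)) = cinner (W (x - y)) 0"
      by (simp add: W.diff)
    then have "Re (cinner (x - y) (x - y)) = inner (W (x - y)) 0"
      using assms by (simp only: unitary_map_def inner_eq_Re_cinner)
    then show "x = y"
      by (simp flip: inner_eq_Re_cinner)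
  qed
  then show ?thesis
    using assms by (simp add: unitary_map_def bij_def)
qed

section \<open>Transitivity and isomorphism of the systems\<close>

theorem theorem2:
  fixes P1 P2 P3 :: "'a::complex_hilbert_space \<Rightarrow> 'a"
    and Q1 Q2 Q3 :: "'b::complex_hilbert_space \<Rightarrow> 'b"
  assumes "\<exists>x::'a. x \<noteq> 0" and "\<exists>x::'b. x \<noteq> 0"
    and "orthogonal_projection P1" and "orthogonal_projection P2" and "orthogonal_projection P3"
    and "mutually_orthogonal P2 P3"
    and "orthogonal_projection Q1" and "orthogonal_projection Q2" and "orthogonal_projection Q3"
    and "mutually_orthogonal Q2 Q3"
  shows "(transitive_system (five_subspaces P1 P2 P3) \<longleftrightarrow>
           irreducible_projections [P1, P2, P3]) \<and>
         (isomorphic_systems (five_subspaces P1 P2 P3) (five_subspaces Q1 Q2 Q3) \<longleftrightarrow>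
           unitarily_equivalent [P1, P2, P3] [Q1, Q2, Q3])"
proof
  note P = assms(3-6) and Q = assms(7-10)
  let ?Ps = "[P1, P2, P3]" and ?Qs = "[Q1, Q2, Q3]"
  let ?S = "five_subspaces P1 P2 P3" and ?T = "five_subspaces Q1 Q2 Q3"
  have projP: "orthogonal_projection A" if "A \<in> set ?Ps" for A
    using that P by auto
  have lin: "linear R" if "bounded_clinear R" for R :: "'c::complex_hilbert_space \<Rightarrow> 'd::complex_hilbert_space"
    using that by (simp add: bounded_clinear_def bounded_linear.linear)
  have End: "End_system ?S = {R. bounded_clinear R \<and> (\<forall>A\<in>set ?Ps. R \<circ> A = A \<circ> R)}"
    using maps_five_subspaces_iff_intertwines[OF lin P(1-3) P]
    by (auto simp: End_system_def list_all2_same simp del: set_simps)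
  have "(\<lambda>x. c *\<^sub>C x) \<in> End_system ?S" for c
    using subspace_system_five_subspaces[OF P]
    by (auto simp: End_system_def bounded_clinear_def bounded_linear_scaleC scaleC_scaleC
        mult.commute subspace_system_def closed_csubspace_def complex_vector.subspace_scale)
  then have "transitive_system ?S \<longleftrightarrow> (\<forall>R\<in>End_system ?S. \<exists>c. R = (\<lambda>x. c *\<^sub>C x))"
    by (auto simp: transitive_system_def)
  also have "\<dots> \<longleftrightarrow> irreducible_projections ?Ps"
    unfolding End
    using irreducible_imp_commutant_scalar[OF projP] commutant_scalar_imp_irreducible[OF projP]
    by blast
  finally show "transitive_system ?S \<longleftrightarrow> irreducible_projections ?Ps" .
  show "isomorphic_systems ?S ?T \<longleftrightarrow> unitarily_equivalent ?Ps ?Qs"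
  proof
    assume "isomorphic_systems ?S ?T"
    then obtain R where R: "bounded_clinear R" "bij R" and "list_all2 (\<lambda>K L. R ` K = L) ?S ?T"
      by (auto simp: isomorphic_systems_def)
    then have "list_all2 (\<lambda>K L. R ` K \<subseteq> L) ?S ?T"
      by (auto elim: list_all2_mono)
    then have RP: "list_all2 (\<lambda>A B. R \<circ> A = B \<circ> R) ?Ps ?Qs"
      using maps_five_subspaces_iff_intertwines[OF lin[OF R(1)] P(1-3) Q] by simp
    obtain W where "unitary_map W"
      and W: "\<And>A B. orthogonal_projection A \<Longrightarrow> orthogonal_projection B \<Longrightarrow>
        R \<circ> A = B \<circ> R \<Longrightarrow> W \<circ> A = B \<circ> W"
      using bijective_intertwiner_imp_unitary_intertwiner[OF R] by blast
    then show "unitarily_equivalent ?Ps ?Qs"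
      using RP P Q by (auto simp: unitarily_equivalent_def)
  next
    assume "unitarily_equivalent ?Ps ?Qs"
    then obtain W where W: "unitary_map W" and WP: "list_all2 (\<lambda>A B. W \<circ> A = B \<circ> W) ?Ps ?Qs"
      by (auto simp: unitarily_equivalent_def)
    have clin: "bounded_clinear W" and "surj W"
      using W by (auto simp: unitary_map_def)
    have onto: "W ` range A = range B" if "\<And>x. W (A x) = B (W x)" for A B
      using that \<open>surj W\<close> by (metis (no_types, lifting) image_image image_cong)
    have "list_all2 (\<lambda>K L. W ` K = L) ?S ?T"
      using WP unfolding five_subspaces_def list.rel_inject
      by (auto intro!: onto simp: proj_compl_def fun_eq_iff linear_diff[OF lin[OF clin]]
          linear_add[OF lin[OF clin]] simp del: image_image)
    then show "isomorphic_systems ?S ?T"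
      using clin unitary_map_bij[OF W] by (auto simp: isomorphic_systems_def)
  qed
qed

end
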